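(* Assume GCH. Let $\lambda,\kappa$ be cardinals with $\lambda\geq\kappa$ and $\lambda\geq\omega$. Then there is a weakly $(\lambda,\kappa)$-universal graph if and only if $\kappa<\omega$ or $\mathrm{cf}(\kappa)>\mathrm{cf}(\lambda)$; likewise, there is a strongly $(\lambda,\kappa)$-universal graph if and only if $\kappa<\omega$ or $\mathrm{cf}(\kappa)>\mathrm{cf}(\lambda)$.
   Context: A graph is a pair $X=(V,E)$ with $E\subseteq[V]^2$. $X$ is $K(\kappa)$-free if there is no $T\subseteq V$ with $|T|=\kappa$ and $[T]^2\subseteq E$. A $(\lambda,\kappa)$-graph is a $K(\kappa)$-free graph whose vertex set has cardinality $\lambda$. For graphs $X_i=(V_i,E_i)$, a one-to-one map $f\colon V_0\to V_1$ is a weak embedding if $\{x,y\}\in E_0$ implies $\{f(x),f(y)\}\in E_1$, and a strong embedding if $\{x,y\}\in E_0 \iff \{f(x),f(y)\}\in E_1$. A weakly (resp. strongly) $(\lambda,\kappa)$-universal graph is a $(\lambda,\kappa)$-graph into which every $(\lambda,\kappa)$-graph weakly (resp. strongly) embeds. GCH is the generalized continuum hypothesis.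
   Formalization: The formal theorem additionally assumes κ ≥ 2; for κ = 0 or 1 every graph of infinite size λ contains a K(κ), so no (λ,κ)-graph and no universal graph exists although κ < ω, and the stated equivalence fails. *)

theory Defs
  imports Main "HOL-Library.Ramsey"
begin

unbundle cardinal_syntax

text \<open>
  Cardinals are represented by relations \<open>r\<close> with \<^term>\<open>Card_order r\<close>; they may live on different
  types and are compared by \<open>\<le>o\<close>, \<open><o\<close> and \<open>=o\<close>.
\<close>

subsection \<open>The generalized continuum hypothesis\<close>

text \<open>
  HOL cannot quantify over types inside a formula, so GCH is stated for the cardinalities of the
  infinite sets of a given type. It holds at every type in any model of GCH, because
  \<^term>\<open>cardSuc r\<close> is the successor of \<open>r\<close> among the cardinals of all types; used as an assumption
  at a single type it is therefore no stronger than full GCH.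
\<close>

definition GCH :: "'a itself \<Rightarrow> bool" where
  "GCH _ \<longleftrightarrow> (\<forall>A :: 'a set. infinite A \<longrightarrow> |Pow A| =o cardSuc |A| )"

subsection \<open>Cofinality\<close>

text \<open>
  The library constant \<^const>\<open>cofinal\<close> requires a strictly larger element, so that no set is cofinal
  in an order with a maximum. The non-strict version below gives every well-order a cofinality
  (0 for 0, and 1 for the other finite cardinals); the two agree on infinite cardinals.
\<close>

definition weakly_cofinal :: "'a set \<Rightarrow> 'a rel \<Rightarrow> bool" where
  "weakly_cofinal K r \<longleftrightarrow> K \<subseteq> Field r \<and> (\<forall>a \<in> Field r. \<exists>b \<in> K. (a, b) \<in> r)"

definition cf :: "'a rel \<Rightarrow> 'a rel" where
  "cf r = (SOME c. \<exists>K. weakly_cofinal K r \<and> c = |K| \<and>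
                       (\<forall>K'. weakly_cofinal K' r \<longrightarrow> |K| \<le>o |K'| ))"

lemma weakly_cofinal_Field:
  assumes "Card_order r"
  shows "weakly_cofinal (Field r) r"
proof -
  have "Refl r"
    using assms unfolding card_order_on_def well_order_on_def linear_order_on_def
      partial_order_on_def preorder_on_def by blast
  then show ?thesis
    unfolding weakly_cofinal_def refl_on_def by blast
qed

lemma cf_exists:
  assumes "Card_order r"
  obtains K where "weakly_cofinal K r" "cf r = |K|"
    "\<And>K'. weakly_cofinal K' r \<Longrightarrow> |K| \<le>o |K'|"
proof -
  define R where "R = card_of ` {K. weakly_cofinal K r}"
  have "R \<noteq> {}"
    using weakly_cofinal_Field[OF assms] unfolding R_def by blast
  moreover have "\<forall>c\<in>R. Card_order c"
    unfolding R_def by (auto simp: card_of_Card_order)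
  ultimately obtain c where "c \<in> R" "\<forall>d\<in>R. c \<le>o d"
    using exists_minim_Card_order by blast
  then have "\<exists>c K. weakly_cofinal K r \<and> c = |K| \<and> (\<forall>K'. weakly_cofinal K' r \<longrightarrow> |K| \<le>o |K'| )"
    unfolding R_def by auto
  from someI_ex[OF this] show ?thesis
    unfolding cf_def[symmetric] using that by blast
qed

lemma weakly_cofinal_iff_cofinal:
  assumes "Card_order r" "infinite (Field r)"
  shows "weakly_cofinal K r \<longleftrightarrow> K \<subseteq> Field r \<and> cofinal K r"
proof
  assume K: "weakly_cofinal K r"
  have "trans r" "antisym r"
    using assms(1) unfolding card_order_on_def well_order_on_def linear_order_on_def
      partial_order_on_def preorder_on_def by blast+
  have "cofinal K r"
    unfolding cofinal_def
  proof
    fix a assume "a \<in> Field r"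
    then obtain a' where a': "a \<noteq> a'" "(a, a') \<in> r"
      using infinite_Card_order_limit[OF assms] by blast
    then have "a' \<in> Field r" unfolding Field_def by blast
    then obtain b where "b \<in> K" "(a', b) \<in> r"
      using K unfolding weakly_cofinal_def by blast
    with a' \<open>trans r\<close> \<open>antisym r\<close> show "\<exists>b\<in>K. a \<noteq> b \<and> (a, b) \<in> r"
      by (metis antisymD transD)
  qed
  with K show "K \<subseteq> Field r \<and> cofinal K r"
    unfolding weakly_cofinal_def by blast
qed (auto simp: weakly_cofinal_def cofinal_def)

lemma regularCard_iff_cf:
  assumes "Card_order r" "infinite (Field r)"
  shows "regularCard r \<longleftrightarrow> cf r =o r"
proof -
  obtain K where K: "weakly_cofinal K r" "cf r = |K|"
    "\<And>K'. weakly_cofinal K' r \<Longrightarrow> |K| \<le>o |K'|"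
    using cf_exists[OF assms(1)] by blast
  have le: "|K'| \<le>o r" if "weakly_cofinal K' r" for K'
    using that assms(1) card_of_mono1 card_of_Field_ordIso ordLeq_ordIso_trans
    unfolding weakly_cofinal_def by blast
  show ?thesis
  proof
    assume "regularCard r"
    then show "cf r =o r"
      using K weakly_cofinal_iff_cofinal[OF assms] unfolding regularCard_def by simp
  next
    assume *: "cf r =o r"
    have "|K'| =o r" if "weakly_cofinal K' r" for K'
      using le[OF that] K(3)[OF that] * K(2)
      by (metis ordIso_iff_ordLeq ordIso_ordLeq_trans ordIso_symmetric)
    then show "regularCard r"
      using weakly_cofinal_iff_cofinal[OF assms] unfolding regularCard_def by simp
  qed
qed

subsection \<open>Graphs without large cliques\<close>

type_synonym 'a graph = "'a set \<times> 'a set set"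

abbreviation verts :: "'a graph \<Rightarrow> 'a set" where "verts \<equiv> fst"
abbreviation edges :: "'a graph \<Rightarrow> 'a set set" where "edges \<equiv> snd"

definition is_graph :: "'a graph \<Rightarrow> bool" where
  "is_graph X \<longleftrightarrow> edges X \<subseteq> [verts X]\<^bsup>2\<^esup>"

definition clique_free :: "'k rel \<Rightarrow> 'a graph \<Rightarrow> bool" where
  "clique_free k X \<longleftrightarrow> \<not> (\<exists>T \<subseteq> verts X. |T| =o k \<and> [T]\<^bsup>2\<^esup> \<subseteq> edges X)"

definition lk_graph :: "'l rel \<Rightarrow> 'k rel \<Rightarrow> 'a graph \<Rightarrow> bool" where
  "lk_graph l k X \<longleftrightarrow> is_graph X \<and> clique_free k X \<and> |verts X| =o l"

definition weak_embedding :: "('a \<Rightarrow> 'b) \<Rightarrow> 'a graph \<Rightarrow> 'b graph \<Rightarrow> bool" where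
  "weak_embedding f X Y \<longleftrightarrow>
     inj_on f (verts X) \<and> f ` verts X \<subseteq> verts Y \<and>
     (\<forall>x \<in> verts X. \<forall>y \<in> verts X. {x, y} \<in> edges X \<longrightarrow> {f x, f y} \<in> edges Y)"

definition strong_embedding :: "('a \<Rightarrow> 'b) \<Rightarrow> 'a graph \<Rightarrow> 'b graph \<Rightarrow> bool" where
  "strong_embedding f X Y \<longleftrightarrow>
     inj_on f (verts X) \<and> f ` verts X \<subseteq> verts Y \<and>
     (\<forall>x \<in> verts X. \<forall>y \<in> verts X. {x, y} \<in> edges X \<longleftrightarrow> {f x, f y} \<in> edges Y)"

text \<open>
  The cardinal \<open>l\<close>, the universal graph and the embedded graphs share one type. This is no
  restriction: a graph of cardinality \<open>l\<close> over any type has an isomorphic copy on \<^term>\<open>Field l\<close>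
  (see \<open>weakly_universal_any_type\<close> and \<open>strongly_universal_any_type\<close> below).
\<close>

definition weakly_universal :: "'a rel \<Rightarrow> 'k rel \<Rightarrow> 'a graph \<Rightarrow> bool" where
  "weakly_universal l k U \<longleftrightarrow>
     lk_graph l k U \<and> (\<forall>X :: 'a graph. lk_graph l k X \<longrightarrow> (\<exists>f. weak_embedding f X U))"

definition strongly_universal :: "'a rel \<Rightarrow> 'k rel \<Rightarrow> 'a graph \<Rightarrow> bool" where
  "strongly_universal l k U \<longleftrightarrow>
     lk_graph l k U \<and> (\<forall>X :: 'a graph. lk_graph l k X \<longrightarrow> (\<exists>f. strong_embedding f X U))"

lemma graph_copy:
  fixes l :: "'a rel" and X :: "'b graph"
  assumes "Card_order l" "lk_graph l k X"
  obtains Y :: "'a graph" and g where "lk_graph l k Y" "strong_embedding g X Y"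
proof -
  have X: "edges X \<subseteq> [verts X]\<^bsup>2\<^esup>" "clique_free k X" "|verts X| =o l"
    using assms(2) unfolding lk_graph_def is_graph_def by auto
  have "|verts X| =o |Field l|"
    using X(3) assms(1) card_of_Field_ordIso ordIso_symmetric ordIso_transitive by blast
  then obtain g where g: "bij_betw g (verts X) (Field l)"
    using card_of_ordIso by blast
  then have inj: "inj_on g (verts X)" and img: "g ` verts X = Field l"
    unfolding bij_betw_def by auto
  define Y where "Y = (Field l, (`) g ` edges X)"
  have edge: "g ` e \<in> (`) g ` edges X \<longleftrightarrow> e \<in> edges X" if "e \<subseteq> verts X" for e
  proof
    assume "g ` e \<in> (`) g ` edges X"
    then obtain d where d: "d \<in> edges X" "g ` e = g ` d" by blast
    then have "d \<subseteq> verts X" using X(1) unfolding nsets_def by blast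
    then have "e = d" using inj_on_image_eq_iff[OF inj that] d(2) by blast
    then show "e \<in> edges X" using d(1) by simp
  qed blast
  have "is_graph Y"
    unfolding is_graph_def
  proof
    fix d assume "d \<in> edges Y"
    then obtain e where e: "e \<in> edges X" "d = g ` e" unfolding Y_def by auto
    then have "e \<subseteq> verts X" "finite e" "card e = 2" using X(1) unfolding nsets_def by auto
    then show "d \<in> [verts Y]\<^bsup>2\<^esup>"
      using e(2) img card_image[OF inj_on_subset[OF inj \<open>e \<subseteq> verts X\<close>]] image_mono[of e "verts X" g]
      unfolding nsets_def Y_def by simp
  qed
  moreover have "clique_free k Y"
    unfolding clique_free_def
  proof
    assume "\<exists>T\<subseteq>verts Y. |T| =o k \<and> [T]\<^bsup>2\<^esup> \<subseteq> edges Y"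
    then obtain T where T: "T \<subseteq> Field l" "|T| =o k" "[T]\<^bsup>2\<^esup> \<subseteq> (`) g ` edges X"
      unfolding Y_def by auto
    obtain S where S: "S \<subseteq> verts X" "T = g ` S"
      using T(1) img subset_imageE by metis
    have "bij_betw g S T"
      using S inj inj_on_subset unfolding bij_betw_def by blast
    then have "|S| =o k"
      using T(2) card_of_ordIso ordIso_transitive by blast
    moreover have "[S]\<^bsup>2\<^esup> \<subseteq> edges X"
    proof
      fix e assume "e \<in> [S]\<^bsup>2\<^esup>"
      then have e: "e \<subseteq> S" "finite e" "card e = 2" unfolding nsets_def by auto
      have sub: "e \<subseteq> verts X" using e(1) S(1) by simp
      have "g ` e \<in> [T]\<^bsup>2\<^esup>"
        using e S(2) card_image[OF inj_on_subset[OF inj sub]] image_mono[of e S g]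
        unfolding nsets_def by simp
      from subsetD[OF T(3) this] have "g ` e \<in> (`) g ` edges X" .
      then show "e \<in> edges X" using edge[OF sub] by simp
    qed
    ultimately show False using X(2) S(1) unfolding clique_free_def by blast
  qed
  moreover have "|verts Y| =o l"
    using assms(1) card_of_Field_ordIso unfolding Y_def by simp
  ultimately have "lk_graph l k Y" unfolding lk_graph_def by blast
  moreover have "strong_embedding g X Y"
    unfolding strong_embedding_def
  proof (intro conjI ballI)
    fix x y assume "x \<in> verts X" "y \<in> verts X"
    then show "({x, y} \<in> edges X) = ({g x, g y} \<in> edges Y)"
      using edge[of "{x, y}"] unfolding Y_def by simp
  qed (use inj img Y_def in auto)
  ultimately show ?thesis using that by blast
qed

lemma weakly_universal_any_type:
  fixes l :: "'a rel" and X :: "'b graph"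
  assumes "Card_order l" "weakly_universal l k U" "lk_graph l k X"
  shows "\<exists>f. weak_embedding f X U"
proof -
  obtain Y :: "'a graph" and g where Y: "lk_graph l k Y" "strong_embedding g X Y"
    by (rule graph_copy[OF assms(1,3)])
  obtain f where f: "weak_embedding f Y U"
    using assms(2) Y(1) unfolding weakly_universal_def by blast
  have g: "inj_on g (verts X)" "g ` verts X \<subseteq> verts Y"
    using Y(2) unfolding strong_embedding_def by simp_all
  have "inj_on (f \<circ> g) (verts X)"
    using comp_inj_on[OF g(1)] inj_on_subset[OF _ g(2)] f unfolding weak_embedding_def by blast
  moreover have "(f \<circ> g) ` verts X \<subseteq> verts U"
    using g(2) f unfolding weak_embedding_def by fastforce
  ultimately have "weak_embedding (f \<circ> g) X U"
    using Y(2) f g(2) unfolding weak_embedding_def strong_embedding_def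
    by (simp add: image_subset_iff)
  then show ?thesis by blast
qed

lemma strongly_universal_any_type:
  fixes l :: "'a rel" and X :: "'b graph"
  assumes "Card_order l" "strongly_universal l k U" "lk_graph l k X"
  shows "\<exists>f. strong_embedding f X U"
proof -
  obtain Y :: "'a graph" and g where Y: "lk_graph l k Y" "strong_embedding g X Y"
    by (rule graph_copy[OF assms(1,3)])
  obtain f where f: "strong_embedding f Y U"
    using assms(2) Y(1) unfolding strongly_universal_def by blast
  have g: "inj_on g (verts X)" "g ` verts X \<subseteq> verts Y"
    using Y(2) unfolding strong_embedding_def by simp_all
  have "inj_on (f \<circ> g) (verts X)"
    using comp_inj_on[OF g(1)] inj_on_subset[OF _ g(2)] f unfolding strong_embedding_def by blast
  moreover have "(f \<circ> g) ` verts X \<subseteq> verts U"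
    using g(2) f unfolding strong_embedding_def by fastforce
  ultimately have "strong_embedding (f \<circ> g) X U"
    using Y(2) f g(2) unfolding strong_embedding_def
    by (simp add: image_subset_iff)
  then show ?thesis by blast
qed

text \<open>
  For \<open>k = 0\<close> and \<open>k = 1\<close> every nonempty graph contains a \<open>K(k)\<close>, so that there are no
  \<open>(l,k)\<close>-graphs at all when \<open>l\<close> is infinite, and hence no universal ones, although \<open>k\<close> is finite.
\<close>

lemma no_lk_graph_below_two:
  assumes "Card_order k" "k <o ctwo" "natLeq \<le>o l"
  shows "\<not> lk_graph l k X"
proof
  assume X: "lk_graph l k X"
  then have "natLeq \<le>o |verts X|"
    using assms(3) ordLeq_ordIso_trans ordIso_symmetric unfolding lk_graph_def by blast
  then have "infinite (verts X)"
    using infinite_iff_natLeq_ordLeq by blast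
  then obtain v where v: "v \<in> verts X"
    by (metis ex_in_conv finite.emptyI)
  have "|Field k| <o |UNIV :: bool set|"
    using assms(1,2) card_of_Field_ordIso ordIso_ordLess_trans unfolding ctwo_def by blast
  then have fin: "finite (Field k)"
    using card_of_ordLeq_finite[OF ordLess_imp_ordLeq] finite_UNIV by blast
  have small: "card (Field k) < 2"
  proof (rule ccontr)
    assume "\<not> card (Field k) < 2"
    then have "card (UNIV :: bool set) \<le> card (Field k)"
      by (simp add: card_UNIV_bool)
    then obtain h :: "bool \<Rightarrow> _" where "inj_on h UNIV" "h ` UNIV \<subseteq> Field k"
      using card_le_inj[OF finite_UNIV fin] by blast
    then have "|UNIV :: bool set| \<le>o |Field k|"
      using card_of_ordLeq by blast
    then show False
      using \<open>|Field k| <o |UNIV :: bool set|\<close> not_ordLess_ordLeq by blast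
  qed
  obtain T where T: "T \<subseteq> {v}" "card T = card (Field k)"
  proof (cases "card (Field k) = 0")
    case True
    then show ?thesis using that[of "{}"] by simp
  next
    case False
    then show ?thesis using small that[of "{v}"] by simp
  qed
  have finT: "finite T" using T(1) finite_subset by blast
  then obtain h where "bij_betw h T (Field k)"
    using T(2) fin finite_same_card_bij by blast
  then have "|T| =o |Field k|"
    using card_of_ordIso by blast
  then have "|T| =o k"
    using assms(1) card_of_Field_ordIso ordIso_transitive by blast
  moreover have "[T]\<^bsup>2\<^esup> = {}"
  proof -
    have "card T < 2" using T(2) small by simp
    then have "card e \<noteq> 2" if "e \<subseteq> T" for e
      using card_mono[OF finT that] by simp
    then show ?thesis
      unfolding nsets_def by auto
  qed
  ultimately show False
    using X T(1) v unfolding lk_graph_def clique_free_def by blast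
qed

end

theory Submission
  imports Defs
begin

text \<open>
  Under GCH every infinite \<open>l\<close> satisfies \<open>2^{<l} = l\<close>, so there are at most \<open>l\<close> pairs of an element of
  \<open>l\<close> and a graph on a proper initial segment of \<open>l\<close>.

  Existence. Fix \<open>C\<close> cofinal in \<open>l\<close> with \<open>|C| = cf l\<close> and \<open>\<rho> x \<in> C\<close> above each \<open>x\<close>. The vertices of the
  universal graph are the pairs \<open>(x, E)\<close> with \<open>E\<close> a \<open>K(k)\<close>-free graph on the elements up to \<open>\<rho> x\<close>;
  \<open>(x, E)\<close> and \<open>(y, F)\<close> with \<open>\<rho> x \<le> \<rho> y\<close> are adjacent iff \<open>E\<close> is the restriction of \<open>F\<close> and \<open>{x, y} \<in> F\<close>.
  A graph \<open>X\<close> embeds by sending \<open>x\<close> to \<open>x\<close> paired with the restriction of \<open>X\<close>. A \<open>k\<close>-clique would have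
  \<open>k\<close> members below one of them with respect to \<open>\<rho>\<close> (by finiteness, or since \<open>|C| < cf k\<close>), and these
  form a clique in the second component of that one.

  Nonexistence. Given \<open>X\<close>, use Kurepa's tree of partial enumerations of cliques: fix \<open>K\<close> cofinal in \<open>k\<close>
  of order type \<open>cf k\<close>, and take as nodes the bounded enumerations \<open>g\<close>, indexed by an initial segment of
  \<open>k\<close> cut off at some \<open>c \<in> K\<close>, of cliques in \<open>X\<close>. Each node is blown up to a clique of fewer than \<open>k\<close>
  points, and points over comparable nodes are joined. A \<open>k\<close>-clique in this graph yields a branch, which
  enumerates a \<open>k\<close>-clique in \<open>X\<close>. A weak embedding into \<open>X\<close> also yields one: recursively extend \<open>g\<close> by the
  image of the block over \<open>g\<close>. The blocks are chosen so large that a sufficiently large part of every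
  image is bounded in \<open>l\<close>, and \<open>cf k \<le> cf l\<close> keeps the enumeration bounded at limits.
\<close>

subsection \<open>Cardinals and cofinality\<close>

lemma Card_order_refl: "Card_order r \<Longrightarrow> a \<in> Field r \<Longrightarrow> (a, a) \<in> r"
  unfolding card_order_on_def order_on_defs refl_on_def by blast

lemma Card_order_transD: "Card_order r \<Longrightarrow> (a, b) \<in> r \<Longrightarrow> (b, c) \<in> r \<Longrightarrow> (a, c) \<in> r"
  unfolding card_order_on_def order_on_defs by (meson transD)

lemma Card_order_antisymD: "Card_order r \<Longrightarrow> (a, b) \<in> r \<Longrightarrow> (b, a) \<in> r \<Longrightarrow> a = b"
  unfolding card_order_on_def order_on_defs by (meson antisymD)

lemma Card_order_total:
  "Card_order r \<Longrightarrow> a \<in> Field r \<Longrightarrow> b \<in> Field r \<Longrightarrow> (a, b) \<in> r \<or> (b, a) \<in> r"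
  by (cases "a = b")
    (auto simp: Card_order_refl card_order_on_def well_order_on_def linear_order_on_def total_on_def)

lemma Card_order_wf: "Card_order r \<Longrightarrow> wf (r - Id)"
  unfolding card_order_on_def well_order_on_def by blast

lemma Card_order_least:
  assumes "Card_order r" "A \<subseteq> Field r" "A \<noteq> {}"
  shows "\<exists>m \<in> A. \<forall>a \<in> A. (m, a) \<in> r"
proof -
  obtain m where m: "m \<in> A" "\<And>y. (y, m) \<in> r - Id \<Longrightarrow> y \<notin> A"
    using wfE_min'[OF Card_order_wf[OF assms(1)] assms(3)] by blast
  have "(m, a) \<in> r" if "a \<in> A" for a
    using m that Card_order_total[OF assms(1), of m a] assms(2) by blast
  with m(1) show ?thesis by blast
qed

lemma card_of_ordIso_Card_order: "Card_order r \<Longrightarrow> r =o |Field r|"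
  by (rule ordIso_symmetric[OF card_of_Field_ordIso])

lemma infinite_Field_iff:
  assumes "Card_order r"
  shows "infinite (Field r) \<longleftrightarrow> natLeq \<le>o r"
proof
  assume "infinite (Field r)"
  then have "natLeq \<le>o |Field r|" using infinite_iff_natLeq_ordLeq by metis
  then show "natLeq \<le>o r" by (rule ordLeq_ordIso_trans) (rule card_of_Field_ordIso[OF assms])
next
  assume "natLeq \<le>o r"
  then have "natLeq \<le>o |Field r|"
    by (rule ordLeq_ordIso_trans) (rule card_of_ordIso_Card_order[OF assms])
  then show "infinite (Field r)" using infinite_iff_natLeq_ordLeq by metis
qed

lemma card_of_under_ordLess:
  assumes "Card_order r" "infinite (Field r)" "a \<in> Field r"
  shows "|under r a| <o r"
proof -
  obtain b where b: "b \<in> Field r" "a \<noteq> b" "(a, b) \<in> r"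
    using infinite_Card_order_limit[OF assms] by blast
  have "under r a \<subseteq> underS r b"
    using b Card_order_transD[OF assms(1)] Card_order_antisymD[OF assms(1)]
    unfolding under_def underS_def by blast
  then show ?thesis
    using card_of_mono1 card_of_underS[OF assms(1) b(1)] ordLeq_ordLess_trans by blast
qed

text \<open>A set smaller than \<open>cf r\<close> is not weakly cofinal, so some \<open>a\<close>
  lies below none of its members; totality turns \<open>a\<close> into a strict upper bound.\<close>

lemma ordLess_cf_bounded:
  assumes "Card_order r" "S \<subseteq> Field r" "|S| <o cf r"
  shows "\<exists>a \<in> Field r. \<forall>s \<in> S. (s, a) \<in> r \<and> s \<noteq> a"
proof -
  obtain K where K: "weakly_cofinal K r" "cf r = |K|"
    "\<And>K'. weakly_cofinal K' r \<Longrightarrow> |K| \<le>o |K'|"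
    using cf_exists[OF assms(1)] by blast
  have "\<not> weakly_cofinal S r"
    using not_ordLess_ordLeq[OF assms(3)] K(3)[of S] unfolding K(2) by blast
  then obtain a where a: "a \<in> Field r" "\<And>s. s \<in> S \<Longrightarrow> (a, s) \<notin> r"
    using assms(2) unfolding weakly_cofinal_def by blast
  have "(s, a) \<in> r \<and> s \<noteq> a" if "s \<in> S" for s
    using a that assms(2) Card_order_total[OF assms(1), of a s] Card_order_refl[OF assms(1)] by blast
  with a(1) show ?thesis by blast
qed

lemma Card_order_cf:
  assumes "Card_order r"
  shows "Card_order (cf r)"
proof -
  obtain K where K: "weakly_cofinal K r" "cf r = |K|"
    "\<And>K'. weakly_cofinal K' r \<Longrightarrow> |K| \<le>o |K'|"
    using cf_exists[OF assms] by blast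
  then show ?thesis by (simp add: card_of_Card_order)
qed

lemma cf_ordLeq:
  assumes "Card_order r"
  shows "cf r \<le>o r"
proof -
  obtain K where K: "weakly_cofinal K r" "cf r = |K|"
    "\<And>K'. weakly_cofinal K' r \<Longrightarrow> |K| \<le>o |K'|"
    using cf_exists[OF assms] by blast
  have "cf r \<le>o |Field r|" unfolding K(2) by (rule K(3)[OF weakly_cofinal_Field[OF assms]])
  then show ?thesis by (rule ordLeq_ordIso_trans) (rule card_of_Field_ordIso[OF assms])
qed

lemma ordLess_Field_subset:
  assumes "Card_order r" "Card_order s" "r <o s"
  obtains B where "B \<subseteq> Field s" "|B| =o r"
proof -
  have "|Field r| \<le>o s"
    using assms card_of_Field_ordIso ordIso_ordLess_trans ordLess_imp_ordLeq by blast
  then obtain B where "B \<subseteq> Field s" "|Field r| =o |B|"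
    using internalize_card_of_ordLeq[of "Field r" s] by blast
  then show thesis
    using that assms(1) card_of_Field_ordIso ordIso_symmetric ordIso_transitive by metis
qed

lemma card_of_finite_ordLess:
  assumes "Card_order r" "infinite (Field r)" "finite A"
  shows "|A| <o r"
proof (rule finite_ordLess_infinite)
  show "Well_order r" using assms(1) unfolding card_order_on_def by blast
qed (use assms card_of_Well_order in \<open>simp_all add: Field_card_of\<close>)

lemma Times_ordLess:
  assumes "Card_order r" "infinite (Field r)" "|A| <o r" "|B| <o r"
  shows "|A \<times> B| <o r"
proof -
  have *: "|C \<times> C| <o r" if "|C| <o r" for C :: "'z set"
  proof (cases "finite C")
    case True
    then show ?thesis by (intro card_of_finite_ordLess assms) simp
  next
    case False
    then show ?thesis
      using ordIso_ordLess_trans[OF card_of_Times_same_infinite that] by blast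
  qed
  from ordLeq_total[OF card_of_Well_order card_of_Well_order]
  consider "|A| \<le>o |B|" | "|B| \<le>o |A|" by blast
  then show ?thesis
  proof cases
    case 1
    show ?thesis by (rule ordLeq_ordLess_trans[OF card_of_Times_mono1[OF 1] *[OF assms(4)]])
  next
    case 2
    show ?thesis by (rule ordLeq_ordLess_trans[OF card_of_Times_mono2[OF 2] *[OF assms(3)]])
  qed
qed

text \<open>The set \<open>D\<close> may live on any type while GCH is assumed at \<open>'a\<close>,
  so \<open>D\<close> is first copied into \<open>Field l\<close>. If the copy \<open>B\<close> is
  infinite, \<open>|Pow B|\<close> is the successor of \<open>|B|\<close> and hence at most
  \<open>l\<close>.\<close>

lemma GCH_Pow_ordLeq:
  fixes l :: "'a rel"
  assumes "GCH TYPE('a)" "Card_order l" "infinite (Field l)" "|D| <o l"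
  shows "|Pow D| \<le>o l"
proof -
  obtain B where B: "B \<subseteq> Field l" "|B| =o |D|"
    using ordLess_Field_subset[OF card_of_Card_order assms(2,4)] by blast
  then obtain h where "bij_betw h B D"
    using card_of_ordIso by blast
  then have "|Pow D| =o |Pow B|"
    using bij_betw_Pow card_of_ordIso ordIso_symmetric by blast
  moreover have "|Pow B| \<le>o l"
  proof (cases "finite B")
    case True
    then show ?thesis
      by (intro ordLess_imp_ordLeq card_of_finite_ordLess assms(2,3)) simp
  next
    case False
    then have "|Pow B| =o cardSuc |B|"
      using assms(1) unfolding GCH_def by blast
    moreover have "cardSuc |B| \<le>o l"
      using cardSuc_least[OF card_of_Card_order assms(2)] B(2) assms(4) ordIso_ordLess_trans
      by blast
    ultimately show ?thesis using ordIso_ordLeq_trans by blast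
  qed
  ultimately show ?thesis using ordIso_ordLeq_trans by blast
qed

text \<open>A pigeonhole principle that also covers singular \<open>k\<close>: if all fibres were
  smaller than \<open>k\<close>, their fewer than \<open>cf k\<close> sizes would have a common
  bound below \<open>k\<close>, and \<open>T\<close> would be no larger than a product of two sets
  smaller than \<open>k\<close>.\<close>

lemma card_of_fibre:
  assumes "Card_order k" "infinite (Field k)" "|S| <o cf k" "|T| =o k" "F ` T \<subseteq> S"
  obtains s where "s \<in> S" "|{t \<in> T. F t = s}| =o k"
proof (rule ccontr)
  note found = that
  assume "\<not> thesis"
  then have none: "\<not> |{t \<in> T. F t = s}| =o k" if "s \<in> S" for s
    using found[OF that] by blast
  have "\<forall>s\<in>S. \<exists>a. a \<in> Field k \<and> |{t \<in> T. F t = s}| \<le>o |underS k a|"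
  proof
    fix s assume s: "s \<in> S"
    have "|{t \<in> T. F t = s}| \<le>o |T|" by (rule card_of_mono1) blast
    then have "|{t \<in> T. F t = s}| \<le>o k" using assms(4) ordLeq_ordIso_trans by blast
    then have "|{t \<in> T. F t = s}| <o k"
      using none[OF s] ordLeq_iff_ordLess_or_ordIso by blast
    \<comment> \<open>A cardinal below \<open>k\<close> is order isomorphic to a proper initial
      segment of \<open>k\<close>, so the sizes of the fibres can be compared through elements of
      \<open>k\<close>.\<close>
    then obtain a where a: "a \<in> Field k" "|{t \<in> T. F t = s}| =o Restr k (underS k a)"
      using ordLess_iff_ordIso_Restr assms(1) card_of_Well_order unfolding card_order_on_def
      by blast
    obtain f where "bij_betw f {t \<in> T. F t = s} (Field (Restr k (underS k a)))"
      using a(2) unfolding ordIso_def iso_def by (auto simp: Field_card_of)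
    then have "|{t \<in> T. F t = s}| \<le>o |Field (Restr k (underS k a))|"
      using card_of_ordIso ordIso_imp_ordLeq by blast
    also have "|Field (Restr k (underS k a))| \<le>o |underS k a|"
      by (rule card_of_mono1) (auto simp: Field_def)
    finally show "\<exists>a. a \<in> Field k \<and> |{t \<in> T. F t = s}| \<le>o |underS k a|" using a(1) by blast
  qed
  from bchoice[OF this] obtain a
    where "\<forall>s\<in>S. a s \<in> Field k \<and> |{t \<in> T. F t = s}| \<le>o |underS k (a s)|" ..
  then have a: "a s \<in> Field k \<and> |{t \<in> T. F t = s}| \<le>o |underS k (a s)|" if "s \<in> S" for s
    using that by (rule bspec)
  have "|a ` S| <o cf k"
    by (rule ordLeq_ordLess_trans[OF card_of_image assms(3)])
  moreover have "a ` S \<subseteq> Field k" using a by blast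
  ultimately obtain b where b: "b \<in> Field k" "\<And>s. s \<in> S \<Longrightarrow> (a s, b) \<in> k"
    using ordLess_cf_bounded[OF assms(1), of "a ` S"] by blast
  have "|{t \<in> T. F t = s}| \<le>o |under k b|" if "s \<in> S" for s
  proof -
    have "underS k (a s) \<subseteq> under k b"
      using b(2)[OF that] Card_order_transD[OF assms(1)] unfolding under_def underS_def by blast
    from ordLeq_transitive[OF conjunct2[OF a[OF that]] card_of_mono1[OF this]]
    show ?thesis .
  qed
  then have 1: "|SIGMA s : S. {t \<in> T. F t = s}| \<le>o |S \<times> under k b|"
    by (intro card_of_Sigma_mono1) blast
  have 2: "|T| \<le>o |SIGMA s : S. {t \<in> T. F t = s}|"
    by (rule surj_imp_ordLeq[of _ snd]) (use assms(5) in force)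
  have "|S| <o k"
    by (rule ordLess_ordLeq_trans[OF assms(3) cf_ordLeq[OF assms(1)]])
  then have "|S \<times> under k b| <o k"
    by (rule Times_ordLess[OF assms(1,2) _
          card_of_under_ordLess[OF assms(1,2) b(1)]])
  then have "|T| <o k"
    by (rule ordLeq_ordLess_trans[OF ordLeq_transitive[OF 2 1]])
  then show False using assms(4) not_ordLess_ordIso by blast
qed

text \<open>
  Thinning a cofinal set of least cardinality along a well-order of it in that order type
  makes its proper initial segments small.
\<close>

lemma thin_cofinal:
  assumes "Card_order r"
  obtains K where "weakly_cofinal K r" "\<And>c. c \<in> K \<Longrightarrow> |{d \<in> K. d \<noteq> c \<and> (d, c) \<in> r}| <o cf r"
proof -
  obtain K where K: "weakly_cofinal K r" "cf r = |K|"
    "\<And>K'. weakly_cofinal K' r \<Longrightarrow> |K| \<le>o |K'|"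
    using cf_exists[OF assms] by blast
  define W where "W = |K|"
  have W: "Card_order W" "Field W = K"
    unfolding W_def using card_of_Card_order[of K] by (simp_all add: Field_card_of)
  \<comment> \<open>These are the members of \<open>K\<close> that are \<open>r\<close>-above
    everything \<open>W\<close> lists before them. On them \<open>r\<close> and \<open>W\<close>
    agree, so their initial segments inherit the smallness of those of \<open>W\<close>.\<close>
  define K' where "K' = {x \<in> K. \<forall>y \<in> K. (y, x) \<in> W \<longrightarrow> y \<noteq> x \<longrightarrow> (y, x) \<in> r}"
  have "weakly_cofinal K' r"
    unfolding weakly_cofinal_def
  proof (intro conjI ballI)
    show "K' \<subseteq> Field r" using K(1) unfolding K'_def weakly_cofinal_def by blast
  next
    fix a assume a: "a \<in> Field r"
    define A where "A = {x \<in> K. (a, x) \<in> r}"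
    have "A \<subseteq> Field W" "A \<noteq> {}"
      using a K(1) W(2) unfolding A_def weakly_cofinal_def by blast+
    \<comment> \<open>The \<open>W\<close>-first member of \<open>K\<close> above \<open>a\<close>
      survives the thinning: an earlier one is not above \<open>a\<close>, hence below
      \<open>a\<close> and so below \<open>m\<close>.\<close>
    then obtain m where m: "m \<in> A" "\<And>x. x \<in> A \<Longrightarrow> (m, x) \<in> W"
      using Card_order_least[OF W(1), of A] by blast
    have "(y, m) \<in> r" if "y \<in> K" "(y, m) \<in> W" "y \<noteq> m" for y
    proof -
      have "(a, y) \<notin> r"
        using m(2)[of y] that Card_order_antisymD[OF W(1)] unfolding A_def by blast
      moreover have "y \<in> Field r" using that(1) K(1) unfolding weakly_cofinal_def by blast
      ultimately have "(y, a) \<in> r" using Card_order_total[OF assms, of y a] a by blast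
      then show ?thesis using m(1) Card_order_transD[OF assms] unfolding A_def by blast
    qed
    then have "m \<in> K'" using m(1) unfolding K'_def A_def by blast
    then show "\<exists>b\<in>K'. (a, b) \<in> r" using m(1) unfolding A_def by blast
  qed
  moreover have "|{d \<in> K'. d \<noteq> c \<and> (d, c) \<in> r}| <o cf r" if "c \<in> K'" for c
  proof -
    have "{d \<in> K'. d \<noteq> c \<and> (d, c) \<in> r} \<subseteq> underS W c"
    proof
      fix d assume d: "d \<in> {d \<in> K'. d \<noteq> c \<and> (d, c) \<in> r}"
      have "(c, d) \<notin> W"
        using d that Card_order_antisymD[OF assms] unfolding K'_def by blast
      then have "(d, c) \<in> W"
        using Card_order_total[OF W(1), of c d] d that W(2) unfolding K'_def by blast
      with d show "d \<in> underS W c" unfolding underS_def by blast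
    qed
    moreover have "|underS W c| <o W"
      by (rule card_of_underS[OF W(1)]) (use that W(2) in \<open>simp add: K'_def\<close>)
    ultimately show ?thesis
      unfolding K(2) W_def[symmetric] by (rule ordLeq_ordLess_trans[OF card_of_mono1])
  qed
  ultimately show thesis using that by blast
qed

subsection \<open>Graphs and embeddings\<close>

lemma nsets_2_subset_iff: "[T]\<^bsup>2\<^esup> \<subseteq> E \<longleftrightarrow> (\<forall>x\<in>T. \<forall>y\<in>T. x \<noteq> y \<longrightarrow> {x, y} \<in> E)"
  by (auto simp: nsets_2_eq)

lemma clique_freeD:
  assumes "clique_free k X" "|T| =o k" "inj_on h T" "h ` T \<subseteq> verts X"
    and "\<And>x y. x \<in> T \<Longrightarrow> y \<in> T \<Longrightarrow> x \<noteq> y \<Longrightarrow> {h x, h y} \<in> edges X"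
  shows False
proof -
  have "|T| =o |h ` T|"
    using assms(3) card_of_ordIso inj_on_imp_bij_betw by blast
  then have "|h ` T| =o k"
    using ordIso_transitive[OF ordIso_symmetric assms(2)] by blast
  moreover have "[h ` T]\<^bsup>2\<^esup> \<subseteq> edges X"
    unfolding nsets_2_subset_iff using assms(5) by blast
  ultimately show False
    using assms(1,4) unfolding clique_free_def by blast
qed

lemma ctwo_other_element:
  assumes "|T| =o k" "ctwo \<le>o k" "x \<in> T"
  shows "\<exists>y\<in>T. y \<noteq> x"
proof -
  have "|UNIV :: bool set| \<le>o |T|"
    using ordLeq_ordIso_trans[OF assms(2) ordIso_symmetric[OF assms(1)]] unfolding ctwo_def .
  then obtain h :: "bool \<Rightarrow> 'a" where h: "inj h" "range h \<subseteq> T"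
    using card_of_ordLeq[of "UNIV :: bool set" T] by blast
  then have "h True \<noteq> h False" by (simp add: inj_eq)
  then show ?thesis using h(2) by (metis range_subsetD)
qed

lemma strong_embedding_comp:
  assumes "strong_embedding g X Y" "strong_embedding f Y Z"
  shows "strong_embedding (f \<circ> g) X Z"
proof -
  have "inj_on (f \<circ> g) (verts X)"
    using assms comp_inj_on inj_on_subset unfolding strong_embedding_def by metis
  then show ?thesis
    using assms unfolding strong_embedding_def by (simp add: image_subset_iff)
qed

lemma weak_embedding_comp:
  assumes "weak_embedding g X Y" "weak_embedding f Y Z"
  shows "weak_embedding (f \<circ> g) X Z"
proof -
  have "inj_on (f \<circ> g) (verts X)"
    using assms comp_inj_on inj_on_subset unfolding weak_embedding_def by metis
  then show ?thesis
    using assms unfolding weak_embedding_def by (simp add: image_subset_iff)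
qed

lemma strong_imp_weak_embedding: "strong_embedding f X Y \<Longrightarrow> weak_embedding f X Y"
  unfolding strong_embedding_def weak_embedding_def by blast

lemma strong_imp_weak_universal: "strongly_universal l k U \<Longrightarrow> weakly_universal l k U"
  unfolding strongly_universal_def weakly_universal_def using strong_imp_weak_embedding by blast

text \<open>Symmetrising \<open>R\<close> and dropping loops makes every relation a graph, so
  adjacency can be specified in one direction only, from lower to higher levels.\<close>

definition adj_graph :: "'v set \<Rightarrow> ('v \<Rightarrow> 'v \<Rightarrow> bool) \<Rightarrow> 'v graph" where
  "adj_graph V R = (V, {{u, v} | u v. u \<in> V \<and> v \<in> V \<and> u \<noteq> v \<and> (R u v \<or> R v u)})"

lemma verts_adj_graph [simp]: "verts (adj_graph V R) = V"
  unfolding adj_graph_def by simp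

lemma edges_adj_graph [simp]:
  "{u, v} \<in> edges (adj_graph V R) \<longleftrightarrow> u \<in> V \<and> v \<in> V \<and> u \<noteq> v \<and> (R u v \<or> R v u)"
  unfolding adj_graph_def by (auto simp: doubleton_eq_iff)

lemma is_graph_adj_graph: "is_graph (adj_graph V R)"
  unfolding is_graph_def adj_graph_def by (auto simp: nsets_2_eq)

lemma is_graph_edgeD:
  assumes "is_graph X" "{x, y} \<in> edges X"
  shows "x \<in> verts X" "y \<in> verts X" "x \<noteq> y"
  using subsetD[OF assms(1)[unfolded is_graph_def] assms(2)] by simp_all

text \<open>Isolated vertices fill up \<open>Field l\<close>. They create no
  \<open>k\<close>-clique: as \<open>k\<close> is at least 2, each clique member has a neighbour and
  so lies in the copy of \<open>Z\<close>. Hence graphs of size at most \<open>l\<close> on any type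
  can stand in for \<open>(l,k)\<close>-graphs on \<open>'a\<close>.\<close>

lemma lk_graph_extension:
  fixes l :: "'a rel" and Z :: "'v graph"
  assumes "Card_order l" "ctwo \<le>o k" "is_graph Z" "clique_free k Z" "|verts Z| \<le>o l"
  obtains Y :: "'a graph" and g
  where "lk_graph l k Y" "verts Y = Field l" "strong_embedding g Z Y"
proof -
  have "|verts Z| \<le>o |Field l|"
    by (rule ordLeq_ordIso_trans[OF assms(5) card_of_ordIso_Card_order[OF assms(1)]])
  then obtain g where g: "inj_on g (verts Z)" "g ` verts Z \<subseteq> Field l"
    using card_of_ordLeq[of "verts Z" "Field l"] by blast
  define R where "R u v \<longleftrightarrow> (\<exists>x\<in>verts Z. \<exists>y\<in>verts Z. u = g x \<and> v = g y \<and> {x, y} \<in> edges Z)" for u v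
  define Y where "Y = adj_graph (Field l) R"
  have R: "R (g x) (g y) \<longleftrightarrow> {x, y} \<in> edges Z" if "x \<in> verts Z" "y \<in> verts Z" for x y
    using that inj_onD[OF g(1)] unfolding R_def by blast
  have edge: "{g x, g y} \<in> edges Y \<longleftrightarrow> {x, y} \<in> edges Z"
    if x: "x \<in> verts Z" and y: "y \<in> verts Z" for x y
  proof -
    have "{x, y} \<in> edges Z \<Longrightarrow> g x \<noteq> g y"
      using is_graph_edgeD(3)[OF assms(3)] inj_onD[OF g(1) _ x y] by blast
    then show ?thesis
      using R[OF x y] R[OF y x] g(2) x y unfolding Y_def by (auto simp: insert_commute)
  qed
  have emb: "strong_embedding g Z Y"
    using g edge unfolding strong_embedding_def by (simp add: Y_def)
  have "clique_free k Y"
    unfolding clique_free_def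
  proof
    assume "\<exists>T\<subseteq>verts Y. |T| =o k \<and> [T]\<^bsup>2\<^esup> \<subseteq> edges Y"
    then obtain T where T: "|T| =o k" "\<And>x y. x \<in> T \<Longrightarrow> y \<in> T \<Longrightarrow> x \<noteq> y \<Longrightarrow> {x, y} \<in> edges Y"
      unfolding nsets_2_subset_iff by blast
    have sub: "T \<subseteq> g ` verts Z"
    proof
      fix x assume x: "x \<in> T"
      obtain y where y: "y \<in> T" "y \<noteq> x"
        using ctwo_other_element[OF T(1) assms(2) x] by blast
      from T(2)[OF x y(1) y(2)[symmetric]] have "R x y \<or> R y x"
        unfolding Y_def by simp
      then show "x \<in> g ` verts Z" unfolding R_def by blast
    qed
    let ?h = "inv_into (verts Z) g"
    have h: "?h x \<in> verts Z" "g (?h x) = x" if "x \<in> T" for x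
      using that sub by (auto simp: inv_into_into f_inv_into_f)
    show False
    proof (rule clique_freeD[OF assms(4) T(1)])
      show "inj_on ?h T" by (rule inj_on_inv_into[OF sub])
      show "?h ` T \<subseteq> verts Z" using h(1) by blast
      fix x y assume "x \<in> T" "y \<in> T" "x \<noteq> y"
      then show "{?h x, ?h y} \<in> edges Z"
        using T(2)[of x y] edge[of "?h x" "?h y"] h by simp
    qed
  qed
  then have "lk_graph l k Y"
    unfolding lk_graph_def using is_graph_adj_graph card_of_Field_ordIso[OF assms(1)]
    by (simp add: Y_def)
  then show thesis
    using that[of Y g] emb by (simp add: Y_def)
qed

subsection \<open>Existence\<close>

lemma card_of_nsets_2_ordLess:
  assumes "Card_order r" "infinite (Field r)" "|A| <o r"
  shows "|[A]\<^bsup>2\<^esup>| <o r"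
proof -
  have "|[A]\<^bsup>2\<^esup>| \<le>o |A \<times> A|"
    by (rule surj_imp_ordLeq[of _ "\<lambda>(x, y). {x, y}"]) (auto simp: nsets_2_eq)
  then show ?thesis
    by (rule ordLeq_ordLess_trans) (rule Times_ordLess[OF assms(1,2,3,3)])
qed

lemma finite_max:
  assumes "Card_order r" "finite F" "F \<noteq> {}" "f ` F \<subseteq> Field r"
  shows "\<exists>m\<in>F. \<forall>a\<in>F. (f a, f m) \<in> r"
  using assms(2-)
proof (induction F rule: finite_ne_induct)
  case (singleton x)
  then show ?case using Card_order_refl[OF assms(1)] by simp
next
  case (insert x F)
  then obtain m where m: "m \<in> F" "\<forall>a\<in>F. (f a, f m) \<in> r" by auto
  have x: "(f x, f x) \<in> r" using Card_order_refl[OF assms(1), of "f x"] insert.prems by simp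
  have "(f x, f m) \<in> r \<or> (f m, f x) \<in> r"
    using Card_order_total[OF assms(1), of "f x" "f m"] insert.prems m(1) by auto
  then show ?case
  proof
    assume "(f x, f m) \<in> r"
    then show ?case using m by blast
  next
    assume "(f m, f x) \<in> r"
    then show ?case using m x Card_order_transD[OF assms(1)] by blast
  qed
qed

proposition strongly_universal_exists:
  fixes l :: "'a rel" and k :: "'k rel"
  assumes gch: "GCH TYPE('a)" and l: "Card_order l" "infinite (Field l)"
    and k: "Card_order k" "ctwo \<le>o k" and fc: "finite (Field k) \<or> cf l <o cf k"
  shows "\<exists>U. strongly_universal l k U"
proof -
  obtain C where C: "weakly_cofinal C l" "cf l = |C|"
    "\<And>K'. weakly_cofinal K' l \<Longrightarrow> |C| \<le>o |K'|"
    using cf_exists[OF l(1)] by blast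
  then have "\<forall>x\<in>Field l. \<exists>c. c \<in> C \<and> (x, c) \<in> l" unfolding weakly_cofinal_def by blast
  then obtain \<rho> where \<rho>: "\<And>x. x \<in> Field l \<Longrightarrow> \<rho> x \<in> C \<and> (x, \<rho> x) \<in> l"
    by metis
  have \<rho>F: "\<rho> x \<in> Field l" if "x \<in> Field l" for x
    using \<rho>[OF that] by (auto simp: Field_def)
  \<comment> \<open>The pairs that a vertex \<open>(x, E)\<close> knows about. They depend only on
    the level \<open>\<rho> x\<close>, and there are at most \<open>cf l\<close> levels.\<close>
  define N where "N x = [under l (\<rho> x)]\<^bsup>2\<^esup>" for x
  define V where "V = (SIGMA x : Field l. {E. E \<subseteq> N x \<and> clique_free k (under l (\<rho> x), E)})"
  define R where "R u v \<longleftrightarrow> (\<rho> (fst u), \<rho> (fst v)) \<in> l \<and> snd u = snd v \<inter> N (fst u)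
    \<and> {fst u, fst v} \<in> snd v" for u v
  define Z where "Z = adj_graph V R"
  have Nmono: "N x \<subseteq> N y" if "(\<rho> x, \<rho> y) \<in> l" for x y
    unfolding N_def using that Card_order_transD[OF l(1)]
    by (intro nsets_mono) (auto simp: under_def)

  \<comment> \<open>The size of the universal graph\<close>
  have "|V| \<le>o l"
    unfolding V_def
  proof (rule card_of_Sigma_ordLeq_infinite_Field[OF l(2,1)], safe)
    show "|Field l| \<le>o l"
      by (rule ordIso_imp_ordLeq[OF card_of_Field_ordIso[OF l(1)]])
    fix x assume x: "x \<in> Field l"
    have "|{E. E \<subseteq> N x \<and> clique_free k (under l (\<rho> x), E)}| \<le>o |Pow (N x)|"
      by (rule card_of_mono1) blast
    moreover have "|N x| <o l"
      unfolding N_def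
      by (intro card_of_nsets_2_ordLess card_of_under_ordLess l \<rho>F x)
    then have "|Pow (N x)| \<le>o l"
      by (rule GCH_Pow_ordLeq[OF gch l])
    ultimately show "|{E. E \<subseteq> N x \<and> clique_free k (under l (\<rho> x), E)}| \<le>o l"
      by (rule ordLeq_transitive)
  qed

  \<comment> \<open>The second component of a member \<open>v\<close> of highest level contains all
    edges between the first coordinates, which thus form a \<open>k\<close>-clique in a graph that
    \<open>V\<close> requires to be \<open>K(k)\<close>-free.\<close>
  have no_clique_with_max: False
    if T: "T \<subseteq> V" "|T| =o k" "\<And>u v. u \<in> T \<Longrightarrow> v \<in> T \<Longrightarrow> u \<noteq> v \<Longrightarrow> R u v \<or> R v u"
      and v: "v \<in> T" "\<And>u. u \<in> T \<Longrightarrow> (\<rho> (fst u), \<rho> (fst v)) \<in> l" for T v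
  proof -
    have V: "fst u \<in> Field l" "snd u \<subseteq> N (fst u)" "clique_free k (under l (\<rho> (fst u)), snd u)"
      if "u \<in> T" for u
      using subsetD[OF T(1) that] unfolding V_def by (cases u; auto)+
    have E: "snd u = snd v \<inter> N (fst u)" if "u \<in> T" for u
    proof (cases "u = v")
      case True
      then show ?thesis using V(2)[OF v(1)] by blast
    next
      case False
      from T(3)[OF that v(1) False] show ?thesis
      proof
        assume "R u v"
        then show ?thesis unfolding R_def by blast
      next
        \<comment> \<open>Adjacency in this direction forces \<open>u\<close> and \<open>v\<close>
          onto one level, where restriction is equality.\<close>
        assume vu: "R v u"
        then have "\<rho> (fst u) = \<rho> (fst v)"
          using v(2)[OF that] Card_order_antisymD[OF l(1)] unfolding R_def by blast
        then have "N (fst u) = N (fst v)" unfolding N_def by simp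
        then show ?thesis using vu V(2)[OF that] unfolding R_def by blast
      qed
    qed
    have edge: "{fst u, fst w} \<in> snd v" if u: "u \<in> T" and w: "w \<in> T" and ne: "u \<noteq> w" for u w
      using T(3)[OF u w ne]
    proof
      assume "R u w"
      then show ?thesis unfolding R_def using E[OF w] by blast
    next
      assume "R w u"
      then show ?thesis unfolding R_def using E[OF u] by (auto simp: insert_commute)
    qed
    show False
    proof (rule clique_freeD[OF V(3)[OF v(1)] T(2)])
      show "inj_on fst T"
      proof (rule inj_onI)
        fix u w assume "u \<in> T" "w \<in> T" "fst u = fst w"
        then show "u = w" using E[of u] E[of w] by (simp add: prod_eq_iff)
      qed
      show "fst ` T \<subseteq> verts (under l (\<rho> (fst v)), snd v)"
      proof
        fix x assume "x \<in> fst ` T"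
        then obtain u where u: "u \<in> T" "x = fst u" by blast
        have "(x, \<rho> x) \<in> l" using \<rho> V(1)[OF u(1)] u(2) by blast
        then have "(x, \<rho> (fst v)) \<in> l"
          using Card_order_transD[OF l(1) _ v(2)[OF u(1)]] u(2) by simp
        then show "x \<in> verts (under l (\<rho> (fst v)), snd v)" by (simp add: under_def)
      qed
    qed (use edge in simp)
  qed

  \<comment> \<open>No \<open>k\<close>-clique in the universal graph\<close>
  have "clique_free k Z"
    unfolding clique_free_def
  proof
    assume "\<exists>T\<subseteq>verts Z. |T| =o k \<and> [T]\<^bsup>2\<^esup> \<subseteq> edges Z"
    then obtain T where T: "T \<subseteq> V" "|T| =o k" "\<And>u v. u \<in> T \<Longrightarrow> v \<in> T \<Longrightarrow> u \<noteq> v \<Longrightarrow> R u v \<or> R v u"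
      unfolding nsets_2_subset_iff Z_def by auto
    have TF: "fst u \<in> Field l" if "u \<in> T" for u
      using subsetD[OF T(1) that] unfolding V_def by (cases u) auto
    show False
    proof (cases "finite (Field k)")
      case True
      have "|T| =o |Field k|"
        by (rule ordIso_transitive[OF T(2) card_of_ordIso_Card_order[OF k(1)]])
      then have "finite T"
        using True card_of_ordIso_finite by blast
      moreover have "T \<noteq> {}"
      proof
        assume "T = {}"
        then have "|UNIV :: bool set| \<le>o |{} :: ('a \<times> 'a set set) set|"
          using ordLeq_ordIso_trans[OF k(2) ordIso_symmetric[OF T(2)]] unfolding ctwo_def by simp
        then show False using card_of_empty3 by blast
      qed
      moreover have "(\<lambda>u. \<rho> (fst u)) ` T \<subseteq> Field l"
        using \<rho>F TF by blast
      ultimately obtain v where "v \<in> T" "\<forall>u\<in>T. (\<rho> (fst u), \<rho> (fst v)) \<in> l"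
        using finite_max[OF l(1), of T "\<lambda>u. \<rho> (fst u)"] by blast
      then show False
        by (intro no_clique_with_max[OF T]) auto
    next
      case False
      \<comment> \<open>With fewer than \<open>cf k\<close> levels, \<open>k\<close> many members of
        the clique share a level, and any one of them has the highest level among these.\<close>
      then have small: "|C| <o cf k" using fc C(2) by simp
      have "(\<lambda>u. \<rho> (fst u)) ` T \<subseteq> C"
        using \<rho> TF by blast
      then obtain c where c: "|{u \<in> T. \<rho> (fst u) = c}| =o k"
        by (rule card_of_fibre[OF k(1) False small T(2)])
      have "infinite {u \<in> T. \<rho> (fst u) = c}"
        using False card_of_ordIso_finite[OF ordIso_transitive[OF c card_of_ordIso_Card_order[OF k(1)]]]
        by blast
      then have "{u \<in> T. \<rho> (fst u) = c} \<noteq> {}" by (rule infinite_imp_nonempty)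
      then obtain v where v: "v \<in> T" "\<rho> (fst v) = c" by blast
      have "(c, c) \<in> l"
        using Card_order_refl[OF l(1) \<rho>F[OF TF[OF v(1)]]] v(2) by simp
      then show False
        by (intro no_clique_with_max[of "{u \<in> T. \<rho> (fst u) = c}" v]) (use T c v in auto)
    qed
  qed
  moreover have "is_graph Z" unfolding Z_def by (rule is_graph_adj_graph)
  moreover have "|verts Z| \<le>o l" using \<open>|V| \<le>o l\<close> unfolding Z_def by simp
  ultimately obtain U :: "'a graph" and g where U: "lk_graph l k U" "strong_embedding g Z U"
    using lk_graph_extension[OF l(1) k(2)] by metis

  \<comment> \<open>Embedding an arbitrary graph\<close>
  have "\<exists>f. strong_embedding f X U" if X: "lk_graph l k X" for X :: "'a graph"
  proof -
    have X': "is_graph X" "clique_free k X" "|verts X| \<le>o l"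
      using X ordIso_imp_ordLeq unfolding lk_graph_def by blast+
    then obtain Y :: "'a graph" and p
      where Y: "lk_graph l k Y" "verts Y = Field l" "strong_embedding p X Y"
      using lk_graph_extension[OF l(1) k(2)] by metis
    have YG: "is_graph Y" "clique_free k Y" using Y(1) unfolding lk_graph_def by blast+
    define e where "e x = (x, edges Y \<inter> N x)" for x
    have eV: "e x \<in> V" if x: "x \<in> Field l" for x
    proof -
      have "under l (\<rho> x) \<subseteq> Field l" by (auto simp: under_def Field_def)
      then have "clique_free k (under l (\<rho> x), edges Y \<inter> N x)"
        using YG(2) Y(2) unfolding clique_free_def by auto
      then show ?thesis using x unfolding V_def e_def by simp
    qed
    \<comment> \<open>The edge is read off at the higher level: both \<open>x\<close> and
      \<open>y\<close> lie below \<open>\<rho> y\<close>, so \<open>{x, y}\<close> belongs to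
      \<open>N y\<close>.\<close>
    have Re: "R (e x) (e y) \<longleftrightarrow> {x, y} \<in> edges Y"
      if x: "x \<in> Field l" and y: "y \<in> Field l" and xy: "(\<rho> x, \<rho> y) \<in> l" and ne: "x \<noteq> y" for x y
    proof -
      have "x \<in> under l (\<rho> y)" "y \<in> under l (\<rho> y)"
        using \<rho>[OF x] \<rho>[OF y] xy Card_order_transD[OF l(1)] by (auto simp: under_def)
      then have "{x, y} \<in> N y" unfolding N_def using ne by simp
      then show ?thesis
        unfolding R_def e_def using Nmono[OF xy] xy by auto
    qed
    have Rimp: "R (e x) (e y) \<Longrightarrow> {x, y} \<in> edges Y" for x y
      unfolding R_def e_def by simp
    have "strong_embedding e Y Z"
      unfolding strong_embedding_def Y(2)
    proof (intro conjI ballI)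
      show "inj_on e (Field l)" by (rule inj_onI) (simp add: e_def)
      show "e ` Field l \<subseteq> verts Z" using eV unfolding Z_def by auto
      fix x y assume x: "x \<in> Field l" and y: "y \<in> Field l"
      show "({x, y} \<in> edges Y) = ({e x, e y} \<in> edges Z)"
      proof (cases "x = y")
        case True
        then show ?thesis
          using is_graph_edgeD(3)[OF YG(1), of x y]
            is_graph_edgeD(3)[OF is_graph_adj_graph[of V R], of "e x" "e y"]
          unfolding Z_def by blast
      next
        case False
        then have "e x \<noteq> e y" unfolding e_def by simp
        moreover have "{x, y} \<in> edges Y \<longleftrightarrow> R (e x) (e y) \<or> R (e y) (e x)"
          using Card_order_total[OF l(1) \<rho>F[OF x] \<rho>F[OF y]] Re[OF x y _ False]
            Re[OF y x _ False[symmetric]] Rimp[of x y] Rimp[of y x]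
          by (auto simp: insert_commute)
        ultimately show ?thesis using eV[OF x] eV[OF y] unfolding Z_def by simp
      qed
    qed
    from strong_embedding_comp[OF Y(3) strong_embedding_comp[OF this U(2)]]
    show ?thesis by blast
  qed
  then show ?thesis using U(1) unfolding strongly_universal_def by blast
qed

subsection \<open>Nonexistence\<close>

text \<open>
  If \<open>k \<le>o cf l\<close> then \<open>B = J\<close> works. Otherwise \<open>k\<close> is singular, hence a limit cardinal, and there is
  room below \<open>k\<close> for a block with more elements than \<open>|C \<times> J|\<close>, where \<open>C\<close> is cofinal in \<open>l\<close> of
  least cardinality.
\<close>

lemma bounded_on_block:
  assumes l: "Card_order l" and k: "Card_order k" "infinite (Field k)"
    and cf: "cf k \<le>o cf l" and J: "J \<subseteq> Field k" "|J| <o k"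
  shows "\<exists>B \<subseteq> Field k. |B| <o k \<and> (\<forall>f. f ` B \<subseteq> Field l \<longrightarrow>
    (\<exists>h. inj_on h J \<and> h ` J \<subseteq> B \<and> (\<exists>b\<in>Field l. \<forall>x\<in>J. (f (h x), b) \<in> l)))"
proof -
  have WO: "Well_order k" "Well_order (cf l)"
    using k(1) Card_order_cf[OF l] unfolding card_order_on_def by blast+
  from ordLess_or_ordLeq[OF WO(2,1)]
  consider (large) "k \<le>o cf l" | (small) "cf l <o k" by blast
  then show ?thesis
  proof cases
    case large
    have "\<exists>h. inj_on h J \<and> h ` J \<subseteq> J \<and> (\<exists>b\<in>Field l. \<forall>x\<in>J. (f (h x), b) \<in> l)"
      if f: "f ` J \<subseteq> Field l" for f
    proof -
      have "|f ` J| <o cf l"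
        by (rule ordLess_ordLeq_trans[OF ordLeq_ordLess_trans[OF card_of_image J(2)] large])
      from ordLess_cf_bounded[OF l f this] have "\<exists>b\<in>Field l. \<forall>x\<in>J. (f (id x), b) \<in> l" by auto
      moreover have "inj_on id J" "id ` J \<subseteq> J" by simp_all
      ultimately show ?thesis by blast
    qed
    then show ?thesis using J by blast
  next
    case small
    obtain C where C: "weakly_cofinal C l" "cf l = |C|" "\<And>K'. weakly_cofinal K' l \<Longrightarrow> |C| \<le>o |K'|"
      using cf_exists[OF l] by blast
    have "\<forall>x\<in>Field l. \<exists>c. c \<in> C \<and> (x, c) \<in> l" using C(1) unfolding weakly_cofinal_def by blast
    then obtain \<gamma> where \<gamma>: "\<And>x. x \<in> Field l \<Longrightarrow> \<gamma> x \<in> C \<and> (x, \<gamma> x) \<in> l"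
      by metis
    define s where "s = cardSuc |C \<times> J|"
    have s: "Card_order s" "|C \<times> J| <o s"
      unfolding s_def using cardSuc_Card_order cardSuc_greater card_of_Card_order by blast+
    have "|C| <o k" using small C(2) by simp
    then have "|C \<times> J| <o k" by (rule Times_ordLess[OF k _ J(2)])
    then have "s \<le>o k" unfolding s_def by (rule cardSuc_least[OF card_of_Card_order k(1)])
    moreover have "\<not> s =o k"
    proof
      \<comment> \<open>Infinite successors are regular, so equality would give
        \<open>k = cf k \<le> cf l\<close> in cardinality, against \<open>small\<close>.\<close>
      assume sk: "s =o k"
      have "|Field s| =o |Field k|"
        using ordIso_transitive[OF ordIso_transitive[OF card_of_Field_ordIso[OF s(1)] sk]
            card_of_ordIso_Card_order[OF k(1)]] .
      then have infs: "infinite (Field s)" using card_of_ordIso_finite k(2) by blast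
      then have "infinite (C \<times> J)"
        unfolding s_def using cardSuc_finite[OF card_of_Card_order, of "C \<times> J"]
        by (simp add: Field_card_of)
      then have "regularCard s"
        unfolding s_def
        by (intro infinite_cardSuc_regularCard card_of_Card_order) (simp add: Field_card_of)
      then have "regularCard k"
        using regularCard_ordIso[OF sk] s(1) infs unfolding cinfinite_def by blast
      then have "cf k =o k" using regularCard_iff_cf[OF k] by blast
      then have "k \<le>o cf l" using ordIso_ordLeq_trans[OF ordIso_symmetric cf] by blast
      then show False using small not_ordLess_ordLeq by blast
    qed
    ultimately have "s <o k" using ordLeq_iff_ordLess_or_ordIso by blast
    then obtain B where B: "B \<subseteq> Field k" "|B| =o s"
      using ordLess_Field_subset[OF s(1) k(1)] by blast
    have "\<exists>h. inj_on h J \<and> h ` J \<subseteq> B \<and> (\<exists>b\<in>Field l. \<forall>x\<in>J. (f (h x), b) \<in> l)"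
      if f: "f ` B \<subseteq> Field l" for f
    proof -
      let ?F = "\<lambda>c. {\<eta>\<in>B. \<gamma> (f \<eta>) = c}"
      \<comment> \<open>If every fibre over \<open>C\<close> had at most \<open>|J|\<close> points,
        \<open>B\<close> would have at most \<open>|C \<times> J|\<close>, less than its size
        \<open>s\<close>. On a large fibre, \<open>c\<close> bounds all values of
        \<open>f\<close>.\<close>
      have "\<exists>c\<in>C. |J| \<le>o |?F c|"
      proof (rule ccontr)
        assume "\<not> (\<exists>c\<in>C. |J| \<le>o |?F c| )"
        then have le: "|?F c| \<le>o |J|" if "c \<in> C" for c
          using that ordLeq_total[OF card_of_Well_order card_of_Well_order] by blast
        have 1: "|B| \<le>o |SIGMA c : C. ?F c|"
          by (rule surj_imp_ordLeq[of _ snd]) (use f \<gamma> in force)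
        have 2: "|SIGMA c : C. ?F c| \<le>o |C \<times> J|"
          by (intro card_of_Sigma_mono1) (use le in blast)
        have "|B| <o s" by (rule ordLeq_ordLess_trans[OF ordLeq_transitive[OF 1 2] s(2)])
        then show False using B(2) not_ordLess_ordIso by blast
      qed
      then obtain c where c: "c \<in> C" "|J| \<le>o |?F c|" by blast
      then obtain h where h: "inj_on h J" "h ` J \<subseteq> ?F c"
        using card_of_ordLeq[of J "?F c"] by blast
      have "c \<in> Field l" using c(1) C(1) unfolding weakly_cofinal_def by blast
      moreover have "(f (h x), c) \<in> l" if "x \<in> J" for x
      proof -
        have "h x \<in> B" "\<gamma> (f (h x)) = c" using h(2) that by blast+
        then show ?thesis using \<gamma>[of "f (h x)"] f by blast
      qed
      ultimately show ?thesis using h by blast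
    qed
    moreover have "|B| <o k" by (rule ordIso_ordLess_trans[OF B(2) \<open>s <o k\<close>])
    ultimately show ?thesis using B(1) by blast
  qed
qed

proposition graph_not_weakly_embeddable:
  fixes l :: "'a rel" and k :: "'k rel" and X :: "'a graph"
  assumes gch: "GCH TYPE('a)" and l: "Card_order l" "infinite (Field l)"
    and k: "Card_order k" "infinite (Field k)" and kl: "k \<le>o l" and cf: "cf k \<le>o cf l"
    and X: "is_graph X" "clique_free k X" "verts X = Field l"
  shows "\<exists>Z :: ('k \<times> ('k \<Rightarrow> 'a) \<times> 'k) graph. is_graph Z \<and> clique_free k Z \<and> |verts Z| \<le>o l \<and>
    (\<forall>f. \<not> weak_embedding f Z X)"
proof -

  \<comment> \<open>The tree of enumerations and its blocks\<close>
  obtain K where K: "weakly_cofinal K k"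
    and small: "\<And>c. c \<in> K \<Longrightarrow> |{d \<in> K. d \<noteq> c \<and> (d, c) \<in> k}| <o cf k"
    by (rule thin_cofinal[OF k(1)]) blast
  have KF: "K \<subseteq> Field k" using K unfolding weakly_cofinal_def by blast
  have "\<forall>x\<in>Field k. \<exists>c. c \<in> K \<and> (x, c) \<in> k \<and> (\<forall>d\<in>K. (x, d) \<in> k \<longrightarrow> (c, d) \<in> k)"
  proof
    fix x assume "x \<in> Field k"
    then have "{c \<in> K. (x, c) \<in> k} \<noteq> {}" using K unfolding weakly_cofinal_def by blast
    then show "\<exists>c. c \<in> K \<and> (x, c) \<in> k \<and> (\<forall>d\<in>K. (x, d) \<in> k \<longrightarrow> (c, d) \<in> k)"
      using Card_order_least[OF k(1), of "{c \<in> K. (x, c) \<in> k}"] KF by blast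
  qed
  \<comment> \<open>\<open>m x\<close> is the least member of \<open>K\<close> at or above
    \<open>x\<close>.\<close>
  then obtain m where m: "\<And>x. x \<in> Field k \<Longrightarrow> m x \<in> K" "\<And>x. x \<in> Field k \<Longrightarrow> (x, m x) \<in> k"
    "\<And>x d. x \<in> Field k \<Longrightarrow> d \<in> K \<Longrightarrow> (x, d) \<in> k \<Longrightarrow> (m x, d) \<in> k"
    by metis
  \<comment> \<open>The nonempty \<open>J c\<close> partition \<open>Field k\<close> into intervals,
    and \<open>P c\<close> is the union of the \<open>J d\<close> with \<open>d \<in> K\<close>
    strictly below \<open>c\<close>. Nodes of level \<open>c\<close> have domain \<open>P c\<close>
    and are extended by choosing values on \<open>J c\<close>.\<close>
  define J where "J c = {x \<in> Field k. m x = c}" for c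
  define P where "P c = {x \<in> Field k. m x \<noteq> c \<and> (m x, c) \<in> k}" for c
  have PF: "P c \<subseteq> Field k" for c unfolding P_def by blast
  have Pmono: "P c \<subseteq> P d" if "(c, d) \<in> k" for c d
    unfolding P_def using that Card_order_transD[OF k(1)] Card_order_antisymD[OF k(1)] by blast
  \<comment> \<open>This allows the later recursion: a value at \<open>x\<close> computed from
    values on \<open>P (m x)\<close> depends on strictly earlier arguments only.\<close>
  have P_less: "(y, x) \<in> k - Id" if x: "x \<in> Field k" and y: "y \<in> P (m x)" for x y
  proof -
    have y': "y \<in> Field k" "m y \<noteq> m x" "(m y, m x) \<in> k" using y unfolding P_def by blast+
    have "(x, y) \<notin> k"
    proof
      assume "(x, y) \<in> k"
      then have "(m x, m y) \<in> k"
        using m(3)[OF x m(1)[OF y'(1)]] m(2)[OF y'(1)] Card_order_transD[OF k(1)] by blast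
      then show False using y' Card_order_antisymD[OF k(1)] by blast
    qed
    then show ?thesis
      using Card_order_total[OF k(1) x y'(1)] y'(2) by blast
  qed
  have small_under: "|A| <o k" if "c \<in> K" "A \<subseteq> under k c" for A c
    using ordLeq_ordLess_trans[OF card_of_mono1[OF that(2)] card_of_under_ordLess[OF k]] that(1) KF
    by blast
  have PK: "|P c| <o k" if "c \<in> K" for c
  proof (rule small_under[OF that])
    show "P c \<subseteq> under k c"
      unfolding P_def under_def using m(2) Card_order_transD[OF k(1)] by blast
  qed
  \<comment> \<open>\<open>B c\<close> will be the block over each node of level \<open>c\<close>:
    every map of it into \<open>l\<close> is bounded on a part of size \<open>|J c|\<close>, enough
    to extend the node over \<open>J c\<close>.\<close>
  have "\<exists>B \<subseteq> Field k. |B| <o k \<and> (\<forall>f. f ` B \<subseteq> Field l \<longrightarrow>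
    (\<exists>h. inj_on h (J c) \<and> h ` J c \<subseteq> B \<and> (\<exists>b\<in>Field l. \<forall>x\<in>J c. (f (h x), b) \<in> l)))"
    if c: "c \<in> K" for c
  proof (rule bounded_on_block[OF l(1) k cf])
    show "J c \<subseteq> Field k" unfolding J_def by blast
    show "|J c| <o k"
      by (rule small_under[OF c]) (use m(2) in \<open>auto simp: J_def under_def\<close>)
  qed
  then have "\<forall>c\<in>K. \<exists>B. B \<subseteq> Field k \<and> |B| <o k \<and> (\<forall>f. f ` B \<subseteq> Field l \<longrightarrow>
    (\<exists>h. inj_on h (J c) \<and> h ` J c \<subseteq> B \<and> (\<exists>b\<in>Field l. \<forall>x\<in>J c. (f (h x), b) \<in> l)))" by simp
  from bchoice[OF this] obtain B where "\<forall>c\<in>K. B c \<subseteq> Field k \<and> |B c| <o k \<and> (\<forall>f. f ` B c \<subseteq> Field l \<longrightarrow>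
    (\<exists>h. inj_on h (J c) \<and> h ` J c \<subseteq> B c \<and> (\<exists>b\<in>Field l. \<forall>x\<in>J c. (f (h x), b) \<in> l)))" ..
  then have BF: "\<And>c. c \<in> K \<Longrightarrow> B c \<subseteq> Field k"
    and Bk: "\<And>c. c \<in> K \<Longrightarrow> |B c| <o k"
    and Bf: "\<And>c f. c \<in> K \<Longrightarrow> f ` B c \<subseteq> Field l \<Longrightarrow>
      \<exists>h. inj_on h (J c) \<and> h ` J c \<subseteq> B c \<and> (\<exists>b\<in>Field l. \<forall>x\<in>J c. (f (h x), b) \<in> l)"
    by simp_all
  \<comment> \<open>\<open>extensional\<close> fixes the values outside \<open>P c\<close>, so nodes
    can be compared by restriction. The bound \<open>b\<close> makes the nodes countable by GCH in
    at most \<open>l\<close> many ways. Injectivity on \<open>P c\<close> is implied, since edges of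
    \<open>X\<close> have distinct ends.\<close>
  define ok where "ok c g \<longleftrightarrow> g \<in> extensional (P c) \<and> (\<exists>b\<in>Field l. \<forall>x\<in>P c. (g x, b) \<in> l) \<and>
    (\<forall>x\<in>P c. \<forall>y\<in>P c. x \<noteq> y \<longrightarrow> {g x, g y} \<in> edges X)" for c g
  define V where "V = {(c, g, \<eta>). c \<in> K \<and> ok c g \<and> \<eta> \<in> B c}"
  define R where "R = (\<lambda>(c, g :: 'k \<Rightarrow> 'a, \<eta> :: 'k) (d, h, \<theta> :: 'k).
    c = d \<and> g = h \<or> c \<noteq> d \<and> (c, d) \<in> k \<and> g = restrict h (P c))"
  define Z where "Z = adj_graph V R"

  \<comment> \<open>The number of vertices of the tree graph\<close>
  have "|V| \<le>o l"
  proof -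
    define G where "G c b = {g \<in> extensional (P c). g ` P c \<subseteq> under l b}" for c b
    have Gl: "|G c b| \<le>o l" if c: "c \<in> K" and b: "b \<in> Field l" for c b
    proof -
      \<comment> \<open>A node is coded by its function graph, a subset of a product smaller than
        \<open>l\<close>.\<close>
      have "inj_on (\<lambda>g. (\<lambda>x. (x, g x)) ` P c) (G c b)"
      proof (rule inj_onI)
        fix g h assume gh: "g \<in> G c b" "h \<in> G c b" "(\<lambda>x. (x, g x)) ` P c = (\<lambda>x. (x, h x)) ` P c"
        then have "g x = h x" if "x \<in> P c" for x
          using that by auto
        then show "g = h"
          using gh(1,2) extensionalityI[of g "P c" h] unfolding G_def by blast
      qed
      moreover have "(\<lambda>g. (\<lambda>x. (x, g x)) ` P c) ` G c b \<subseteq> Pow (P c \<times> under l b)"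
        unfolding G_def by auto
      ultimately have le: "|G c b| \<le>o |Pow (P c \<times> under l b)|"
        using card_of_ordLeq by blast
      have "|P c \<times> under l b| <o l"
        by (rule Times_ordLess[OF l ordLess_ordLeq_trans[OF PK[OF c] kl]
              card_of_under_ordLess[OF l b]])
      then have "|Pow (P c \<times> under l b)| \<le>o l"
        by (rule GCH_Pow_ordLeq[OF gch l])
      then show ?thesis by (rule ordLeq_transitive[OF le])
    qed
    have Fl: "|Field l| \<le>o l"
      by (rule ordIso_imp_ordLeq[OF card_of_Field_ordIso[OF l(1)]])
    have Fk: "|Field k| \<le>o l"
      by (rule ordIso_ordLeq_trans[OF card_of_Field_ordIso[OF k(1)] kl])
    have Kl: "|K| \<le>o l"
      by (rule ordLeq_transitive[OF card_of_mono1[OF KF] Fk])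
    have "|\<Union>c\<in>K. \<Union>b\<in>Field l. G c b| \<le>o l"
      by (intro card_of_UNION_ordLeq_infinite_Field[OF l(2,1)] ballI Kl Fl Gl)
    then have "|K \<times> (\<Union>c\<in>K. \<Union>b\<in>Field l. G c b) \<times> Field k| \<le>o l"
      by (intro card_of_Times_ordLeq_infinite_Field[OF l(2) _ _ l(1)] Kl Fk)
    moreover have "V \<subseteq> K \<times> (\<Union>c\<in>K. \<Union>b\<in>Field l. G c b) \<times> Field k"
    proof
      fix u assume "u \<in> V"
      then obtain c g \<eta> where u: "u = (c, g, \<eta>)" "c \<in> K" "ok c g" "\<eta> \<in> Field k"
        unfolding V_def using BF by blast
      then obtain b where "b \<in> Field l" "g \<in> G c b"
        unfolding ok_def G_def under_def by blast
      then show "u \<in> K \<times> (\<Union>c\<in>K. \<Union>b\<in>Field l. G c b) \<times> Field k" using u by blast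
    qed
    ultimately show ?thesis
      using ordLeq_transitive[OF card_of_mono1] by blast
  qed

  \<comment> \<open>No \<open>k\<close>-clique in the tree graph\<close>
  moreover have "clique_free k Z"
    unfolding clique_free_def
  proof
    assume "\<exists>T\<subseteq>verts Z. |T| =o k \<and> [T]\<^bsup>2\<^esup> \<subseteq> edges Z"
    then obtain T where T: "T \<subseteq> V" "|T| =o k" "\<And>u v. u \<in> T \<Longrightarrow> v \<in> T \<Longrightarrow> u \<noteq> v \<Longrightarrow> R u v \<or> R v u"
      unfolding nsets_2_subset_iff Z_def by auto
    have TV: "fst u \<in> K" "ok (fst u) (fst (snd u))" "snd (snd u) \<in> B (fst u)" if "u \<in> T" for u
      using subsetD[OF T(1) that] unfolding V_def by (cases u; auto)+
    have T_eq: "fst (snd u) = fst (snd v)" if "u \<in> T" "v \<in> T" "fst u = fst v" for u v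
    proof (cases "u = v")
      case False
      from T(3)[OF that(1,2) this] that(3) show ?thesis
        unfolding R_def by (cases u; cases v) auto
    qed simp
    have coherent: "fst (snd u) x = fst (snd v) x"
      if "u \<in> T" "v \<in> T" "x \<in> P (fst u)" "x \<in> P (fst v)" for u v x
    proof (cases "u = v")
      case False
      from T(3)[OF that(1,2) this] that(3,4) show ?thesis
        unfolding R_def by (cases u; cases v) auto
    qed simp
    \<comment> \<open>If all levels in \<open>T\<close> stayed below \<open>a\<close>, there would
      be fewer than \<open>cf k\<close> of them, as initial segments of \<open>K\<close> are small.
      Then \<open>k\<close> members would share a level, hence a node, but its block is smaller than
      \<open>k\<close>.\<close>
    have cofinal: "\<exists>u\<in>T. (a, fst u) \<in> k" if a: "a \<in> Field k" for a
    proof (rule ccontr)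
      assume no: "\<not> (\<exists>u\<in>T. (a, fst u) \<in> k)"
      obtain c where c: "c \<in> K" "(a, c) \<in> k" using K a unfolding weakly_cofinal_def by blast
      have "fst ` T \<subseteq> {d \<in> K. d \<noteq> c \<and> (d, c) \<in> k}"
      proof
        fix d assume "d \<in> fst ` T"
        then obtain u where u: "u \<in> T" "d = fst u" by blast
        have d: "d \<in> K" "(a, d) \<notin> k" using TV(1)[OF u(1)] u no by blast+
        then have "(d, a) \<in> k" using Card_order_total[OF k(1) a, of d] KF by blast
        then show "d \<in> {d \<in> K. d \<noteq> c \<and> (d, c) \<in> k}"
          using c(2) d Card_order_transD[OF k(1)] by blast
      qed
      then obtain s where s: "s \<in> {d \<in> K. d \<noteq> c \<and> (d, c) \<in> k}" "|{u \<in> T. fst u = s}| =o k"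
        by (rule card_of_fibre[OF k small[OF c(1)] T(2)])
      have "inj_on (\<lambda>u. snd (snd u)) {u \<in> T. fst u = s}"
      proof (rule inj_onI)
        fix u v assume "u \<in> {u \<in> T. fst u = s}" "v \<in> {u \<in> T. fst u = s}" "snd (snd u) = snd (snd v)"
        then show "u = v" using T_eq[of u v] by (simp add: prod_eq_iff)
      qed
      moreover have "(\<lambda>u. snd (snd u)) ` {u \<in> T. fst u = s} \<subseteq> B s" using TV(3) by blast
      ultimately have le: "|{u \<in> T. fst u = s}| \<le>o |B s|" using card_of_ordLeq by blast
      have "|{u \<in> T. fst u = s}| <o k"
        by (rule ordLeq_ordLess_trans[OF le Bk]) (use s(1) in blast)
      then show False using s(2) not_ordLess_ordIso by blast
    qed
    have "\<forall>x\<in>Field k. \<exists>u. u \<in> T \<and> x \<in> P (fst u)"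
    proof
      fix x assume x: "x \<in> Field k"
      have "m x \<in> Field k" using m(1)[OF x] KF by blast
      from infinite_Card_order_limit[OF k this]
      obtain a where a: "a \<in> Field k" "m x \<noteq> a" "(m x, a) \<in> k" by blast
      from cofinal[OF a(1)] obtain u where u: "u \<in> T" "(a, fst u) \<in> k" by blast
      have "(m x, fst u) \<in> k" by (rule Card_order_transD[OF k(1) a(3) u(2)])
      moreover have "m x \<noteq> fst u"
        using a(2) Card_order_antisymD[OF k(1) a(3)] u(2) by auto
      ultimately
      show "\<exists>u. u \<in> T \<and> x \<in> P (fst u)" using u(1) x unfolding P_def by blast
    qed
    from bchoice[OF this] obtain t where "\<forall>x\<in>Field k. t x \<in> T \<and> x \<in> P (fst (t x))" ..
    then have t: "t x \<in> T \<and> x \<in> P (fst (t x))" if "x \<in> Field k" for x using that by blast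
    \<comment> \<open>The union of the branch: by \<open>coherent\<close>, every member of
      \<open>T\<close> whose node is defined at \<open>x\<close> gives the same value there.\<close>
    define h where "h x = fst (snd (t x)) x" for x
    have edge: "{h x, h y} \<in> edges X" if x: "x \<in> Field k" and y: "y \<in> Field k" and ne: "x \<noteq> y" for x y
    proof -
      have "\<exists>u\<in>T. x \<in> P (fst u) \<and> y \<in> P (fst u)"
        using Card_order_total[OF k(1), of "fst (t x)" "fst (t y)"]
          TV(1) t[OF x] t[OF y] KF Pmono by blast
      then obtain u where u: "u \<in> T" "x \<in> P (fst u)" "y \<in> P (fst u)" by blast
      then have "{fst (snd u) x, fst (snd u) y} \<in> edges X"
        using TV(2)[OF u(1)] ne unfolding ok_def by blast
      moreover have "fst (snd u) x = h x" "fst (snd u) y = h y"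
        unfolding h_def using coherent u t[OF x] t[OF y] by blast+
      ultimately show ?thesis by simp
    qed
    show False
    proof (rule clique_freeD[OF X(2) card_of_Field_ordIso[OF k(1)]])
      show "inj_on h (Field k)"
        using is_graph_edgeD(3)[OF X(1) edge] by (meson inj_onI)
      show "h ` Field k \<subseteq> verts X"
      proof
        fix z assume "z \<in> h ` Field k"
        then obtain x where x: "x \<in> Field k" "z = h x" by blast
        then show "z \<in> verts X"
          using TV(2)[of "t x"] t[OF x(1)] unfolding X(3) ok_def h_def by (auto simp: Field_def)
      qed
    qed (rule edge)
  qed

  \<comment> \<open>No weak embedding of the tree graph\<close>
  moreover have "\<not> weak_embedding f Z X" for f
  proof
    assume f: "weak_embedding f Z X"
    have fF: "f u \<in> Field l" if "u \<in> V" for u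
      using f that unfolding weak_embedding_def X(3)[symmetric] Z_def by auto
    have fedge: "{f u, f v} \<in> edges X" if "u \<in> V" "v \<in> V" "u \<noteq> v" "R u v \<or> R v u" for u v
      using f that unfolding weak_embedding_def Z_def by simp
    have "\<exists>h. inj_on h (J c) \<and> h ` J c \<subseteq> B c \<and> (\<exists>b\<in>Field l. \<forall>x\<in>J c. (f (c, g, h x), b) \<in> l)"
      if "c \<in> K" "ok c g" for c g
      using that by (intro Bf) (auto simp: V_def intro!: fF)
    then have "\<forall>c g. \<exists>h. c \<in> K \<and> ok c g \<longrightarrow>
      inj_on h (J c) \<and> h ` J c \<subseteq> B c \<and> (\<exists>b\<in>Field l. \<forall>x\<in>J c. (f (c, g, h x), b) \<in> l)" by blast
    \<comment> \<open>\<open>H c g\<close> selects, from the block over \<open>g\<close>, distinct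
      points indexed by \<open>J c\<close> whose images under \<open>f\<close> have a common
      bound.\<close>
    then obtain H where "\<forall>c g. c \<in> K \<and> ok c g \<longrightarrow>
      inj_on (H c g) (J c) \<and> H c g ` J c \<subseteq> B c \<and> (\<exists>b\<in>Field l. \<forall>x\<in>J c. (f (c, g, H c g x), b) \<in> l)"
      by metis
    then have H: "inj_on (H c g) (J c)" "H c g ` J c \<subseteq> B c"
      "\<exists>b\<in>Field l. \<forall>x\<in>J c. (f (c, g, H c g x), b) \<in> l" if "c \<in> K" "ok c g" for c g
      using that by simp_all
    \<comment> \<open>The values found so far, restricted to \<open>P (m x)\<close>, will turn out
      to be a node; the new value is the \<open>f\<close>-image of the point selected for
      \<open>x\<close> in the block over it.\<close>
    define \<Psi> where "\<Psi> \<phi> x = f (m x, restrict \<phi> (P (m x)), H (m x) (restrict \<phi> (P (m x))) x)" for \<phi> x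
    define \<Phi> where "\<Phi> = wfrec (k - Id) \<Psi>"
    define g where "g c = restrict \<Phi> (P c)" for c
    have \<Phi>: "\<Phi> x = f (m x, g (m x), H (m x) (g (m x)) x)" if x: "x \<in> Field k" for x
    proof -
      \<comment> \<open>\<open>cut\<close> puts a default value at points not below
        \<open>x\<close>, but \<open>P (m x)\<close> contains only points below
        \<open>x\<close>.\<close>
      have "restrict (cut \<Phi> (k - Id) x) (P (m x)) = g (m x)"
        unfolding g_def using P_less[OF x] by (auto simp: restrict_def cut_def)
      then show ?thesis
        using wfrec[OF Card_order_wf[OF k(1)], of \<Psi> x] unfolding \<Phi>_def[symmetric] \<Psi>_def by simp
    qed
    \<comment> \<open>Assuming \<open>ok\<close> only at the two levels makes this usable inside the
      induction that proves \<open>ok\<close>. Both nodes are restrictions of \<open>\<Phi>\<close>,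
      hence comparable, so the selected points are adjacent in \<open>Z\<close>.\<close>
    have edge: "{\<Phi> x, \<Phi> y} \<in> edges X"
      if x: "x \<in> Field k" and y: "y \<in> Field k" and ne: "x \<noteq> y"
        and ok: "ok (m x) (g (m x))" "ok (m y) (g (m y))"
      for x y
    proof -
      let ?u = "(m x, g (m x), H (m x) (g (m x)) x)" and ?v = "(m y, g (m y), H (m y) (g (m y)) y)"
      have J: "x \<in> J (m x)" "y \<in> J (m y)" using x y unfolding J_def by simp_all
      have V: "?u \<in> V" "?v \<in> V"
        using H(2)[OF m(1)[OF x] ok(1)] H(2)[OF m(1)[OF y] ok(2)] J m(1)[OF x] m(1)[OF y] ok
        unfolding V_def by auto
      have neq: "?u \<noteq> ?v"
        using inj_onD[OF H(1)[OF m(1)[OF x] ok(1)] _ J(1)] J(2) ne by auto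
      have gR: "g c = restrict (g d) (P c)" if "(c, d) \<in> k" for c d
        unfolding g_def using Pmono[OF that] by (simp add: Int_absorb1)
      have "m x \<in> Field k" "m y \<in> Field k" using m(1) x y KF by blast+
      then consider "m x = m y" | "m x \<noteq> m y" "(m x, m y) \<in> k" | "m y \<noteq> m x" "(m y, m x) \<in> k"
        using Card_order_total[OF k(1), of "m x" "m y"] by metis
      then have "R ?u ?v \<or> R ?v ?u"
      proof cases
        case 1
        then show ?thesis unfolding R_def by simp
      next
        case 2
        then have "R ?u ?v" using gR[OF 2(2)] unfolding R_def prod.case by blast
        then show ?thesis ..
      next
        case 3
        then have "R ?v ?u" using gR[OF 3(2)] unfolding R_def prod.case by blast
        then show ?thesis ..
      qed
      from fedge[OF V neq this] show ?thesis unfolding \<Phi>[OF x] \<Phi>[OF y] .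
    qed
    have ok: "ok c (g c)" if "c \<in> K" for c
      using that
    proof (induction c rule: wf_induct_rule[OF Card_order_wf[OF k(1)]])
      case (1 c)
      define S where "S = {d \<in> K. d \<noteq> c \<and> (d, c) \<in> k}"
      have okS: "ok d (g d)" if "d \<in> S" for d
        using 1(1)[of d] that unfolding S_def by blast
      have PS: "m x \<in> S" if "x \<in> P c" for x
        using that m(1) unfolding P_def S_def by blast
      have "\<forall>d\<in>S. \<exists>b. b \<in> Field l \<and> (\<forall>x\<in>J d. (\<Phi> x, b) \<in> l)"
      proof
        fix d assume d: "d \<in> S"
        have "d \<in> K" using d unfolding S_def by blast
        from H(3)[OF this okS[OF d]]
        show "\<exists>b. b \<in> Field l \<and> (\<forall>x\<in>J d. (\<Phi> x, b) \<in> l)" using \<Phi> unfolding J_def by auto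
      qed
      from bchoice[OF this] obtain b where b: "\<forall>d\<in>S. b d \<in> Field l \<and> (\<forall>x\<in>J d. (\<Phi> x, b d) \<in> l)" by blast
      \<comment> \<open>Fewer than \<open>cf k \<le> cf l\<close> levels precede \<open>c\<close>,
        so the bounds for the separate pieces \<open>J d\<close> have a common bound and
        \<open>g c\<close> is again bounded.\<close>
      have "|b ` S| <o cf l"
        using ordLess_ordLeq_trans[OF ordLeq_ordLess_trans[OF card_of_image small[OF 1(2)]] cf]
        unfolding S_def .
      moreover have "b ` S \<subseteq> Field l" using b by blast
      ultimately obtain a where a: "a \<in> Field l" "\<forall>d\<in>S. (b d, a) \<in> l"
        using ordLess_cf_bounded[OF l(1), of "b ` S"] by blast
      have "(g c x, a) \<in> l" if x: "x \<in> P c" for x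
      proof -
        have "x \<in> J (m x)" using x unfolding P_def J_def by blast
        then have "(\<Phi> x, b (m x)) \<in> l" "(b (m x), a) \<in> l" using PS[OF x] a b by blast+
        from Card_order_transD[OF l(1) this] show ?thesis using x unfolding g_def by simp
      qed
      moreover have "{g c x, g c y} \<in> edges X" if "x \<in> P c" "y \<in> P c" "x \<noteq> y" for x y
        using edge[of x y] that okS PS PF unfolding g_def by auto
      moreover have "g c \<in> extensional (P c)" unfolding g_def by simp
      ultimately show ?case using a(1) unfolding ok_def by blast
    qed
    have final: "{\<Phi> x, \<Phi> y} \<in> edges X" if "x \<in> Field k" "y \<in> Field k" "x \<noteq> y" for x y
      using edge[OF that ok[OF m(1)[OF that(1)]] ok[OF m(1)[OF that(2)]]] .
    show False
    proof (rule clique_freeD[OF X(2) card_of_Field_ordIso[OF k(1)]])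
      show "inj_on \<Phi> (Field k)"
        using is_graph_edgeD(3)[OF X(1) final] by (meson inj_onI)
      show "\<Phi> ` Field k \<subseteq> verts X"
      proof
        fix z assume "z \<in> \<Phi> ` Field k"
        then obtain x where x: "x \<in> Field k" "z = \<Phi> x" by blast
        have "(m x, g (m x), H (m x) (g (m x)) x) \<in> V"
          using H(2)[OF m(1)[OF x(1)] ok[OF m(1)[OF x(1)]]] x(1) m(1)[OF x(1)] ok[OF m(1)[OF x(1)]]
          unfolding V_def J_def by auto
        then show "z \<in> verts X" using fF \<Phi>[OF x(1)] x(2) X(3) by simp
      qed
    qed (rule final)
  qed
  moreover have "is_graph Z" unfolding Z_def by (rule is_graph_adj_graph)
  moreover have "verts Z = V" unfolding Z_def by simp
  ultimately show ?thesis by (intro exI[of _ Z] conjI allI) simp_all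
qed

text \<open>A universal \<open>U\<close> is padded to a graph \<open>X\<close> on
  \<open>Field l\<close>, and the graph \<open>Z\<close> that does not embed into \<open>X\<close>
  is padded to an \<open>(l,k)\<close>-graph \<open>Y\<close> on \<open>'a\<close>. Universality
  would give weak embeddings from \<open>Z\<close> to \<open>Y\<close> to \<open>U\<close> to
  \<open>X\<close>.\<close>

corollary no_weakly_universal:
  fixes l :: "'a rel" and k :: "'k rel"
  assumes gch: "GCH TYPE('a)" and l: "Card_order l" "infinite (Field l)"
    and k: "Card_order k" "infinite (Field k)" and kl: "k \<le>o l" and cf: "cf k \<le>o cf l"
    and two: "ctwo \<le>o k"
  shows "\<not> weakly_universal l k U"
proof
  assume U: "weakly_universal l k U"
  then have U': "is_graph U" "clique_free k U" "|verts U| \<le>o l"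
    using ordIso_imp_ordLeq unfolding weakly_universal_def lk_graph_def by blast+
  obtain X :: "'a graph" and p
    where X: "lk_graph l k X" "verts X = Field l" "strong_embedding p U X"
    by (rule lk_graph_extension[OF l(1) two U'])
  then have "is_graph X" "clique_free k X" unfolding lk_graph_def by blast+
  from graph_not_weakly_embeddable[OF gch l k kl cf this X(2)]
  obtain Z :: "('k \<times> ('k \<Rightarrow> 'a) \<times> 'k) graph"
    where Z: "is_graph Z" "clique_free k Z" "|verts Z| \<le>o l" "\<And>f. \<not> weak_embedding f Z X"
    by blast
  obtain Y :: "'a graph" and q where Y: "lk_graph l k Y" "strong_embedding q Z Y"
    by (rule lk_graph_extension[OF l(1) two Z(1-3)])
  obtain f where "weak_embedding f Y U"
    using U Y(1) unfolding weakly_universal_def by blast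
  from weak_embedding_comp[OF weak_embedding_comp[OF strong_imp_weak_embedding[OF Y(2)] this]
      strong_imp_weak_embedding[OF X(3)]]
  show False using Z(4) by blast
qed

theorem theorem1:
  fixes l :: "'a rel" and k :: "'k rel"
  assumes "GCH TYPE('a)"
    and "Card_order l" and "Card_order k"
    and "k \<le>o l" and "natLeq \<le>o l"
    and "ctwo \<le>o k"
  shows "((\<exists>U. weakly_universal l k U) \<longleftrightarrow> k <o natLeq \<or> cf l <o cf k) \<and>
         ((\<exists>U. strongly_universal l k U) \<longleftrightarrow> k <o natLeq \<or> cf l <o cf k)"
proof -
  have l: "infinite (Field l)"
    using infinite_Field_iff[OF assms(2)] assms(5) by blast
  have WO: "Well_order k" "Well_order (cf k)" "Well_order (cf l)"
    using assms(2,3) Card_order_cf unfolding card_order_on_def by blast+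
  have fin: "finite (Field k) \<longleftrightarrow> k <o natLeq"
    using infinite_Field_iff[OF assms(3)] not_ordLeq_iff_ordLess[OF WO(1) natLeq_Well_order]
    by blast
  \<comment> \<open>Existence in the strong sense and nonexistence in the weak sense settle both
    equivalences, as strong universality implies weak universality.\<close>
  show ?thesis
  proof (cases "k <o natLeq \<or> cf l <o cf k")
    case True
    then have "finite (Field k) \<or> cf l <o cf k" using fin by blast
    then obtain U where "strongly_universal l k U"
      using strongly_universal_exists[OF assms(1,2) l assms(3,6)] by blast
    then show ?thesis using True strong_imp_weak_universal by blast
  next
    case False
    then have "infinite (Field k)" "cf k \<le>o cf l"
      using fin not_ordLess_iff_ordLeq[OF WO(2,3)] by blast+
    then have "\<not> weakly_universal l k U" for U
      by (intro no_weakly_universal[OF assms(1,2) l assms(3) _ assms(4) _ assms(6)])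
    then show ?thesis using False strong_imp_weak_universal by blast
  qed
qed

end
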